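(* Let $R$ be a ring. Then the ring $T_2(R)$ of $2\times 2$ upper triangular matrices over $R$ is LNZS if and only if $R$ is reduced.
   Context: All rings are associative with identity. $N(R)$ denotes the set of nilpotent elements of a ring $R$. For $a\in R$, $l(a)=\{x\in R: xa=0\}$ is the left annihilator of $a$. A ring $R$ is called left nil zero semicommutative (LNZS) if $l(a)$ is a (two-sided) ideal of $R$ for every $a\in N(R)$. A ring $R$ is reduced if $N(R)=0$. *)

theory Defs
  imports "HOL-Algebra.Ideal" "Jordan_Normal_Form.Matrix"
begin

definition nilpotents :: "('a, 'b) ring_scheme \<Rightarrow> 'a set" where
  "nilpotents R = {a \<in> carrier R. \<exists>n::nat. n \<ge> 1 \<and> a [^]\<^bsub>R\<^esub> n = \<zero>\<^bsub>R\<^esub>}"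

definition left_annihilator :: "('a, 'b) ring_scheme \<Rightarrow> 'a \<Rightarrow> 'a set" where
  "left_annihilator R a = {x \<in> carrier R. x \<otimes>\<^bsub>R\<^esub> a = \<zero>\<^bsub>R\<^esub>}"

definition reduced_ring :: "('a, 'b) ring_scheme \<Rightarrow> bool" where
  "reduced_ring R \<longleftrightarrow> ring R \<and> nilpotents R = {\<zero>\<^bsub>R\<^esub>}"

definition LNZS :: "('a, 'b) ring_scheme \<Rightarrow> bool" where
  "LNZS R \<longleftrightarrow> ring R \<and> (\<forall>a \<in> nilpotents R. ideal (left_annihilator R a) R)"

(* The ring T_n(R).  Matrix indices start at 0.  The entries live in the carrier of R and
   are combined with the operations of R, so the type-class operations on 'a mat
   (and ring_mat, upper_triangular built on them) do not apply here.
   Plain "mult" would be read as Multiset.mult, hence the qualified field name. *)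
definition upper_triangular_ring :: "nat \<Rightarrow> ('a, 'b) ring_scheme \<Rightarrow> 'a mat ring" where
  "upper_triangular_ring n R =
    \<lparr>carrier = {A \<in> carrier_mat n n.
        (\<forall>i<n. \<forall>j<n. A $$ (i, j) \<in> carrier R) \<and>
        (\<forall>i<n. \<forall>j<i. A $$ (i, j) = \<zero>\<^bsub>R\<^esub>)},
     monoid.mult = (\<lambda>A B. mat n n (\<lambda>(i, j). \<Oplus>\<^bsub>R\<^esub>k\<in>{..<n}. A $$ (i, k) \<otimes>\<^bsub>R\<^esub> B $$ (k, j))),
     one = mat n n (\<lambda>(i, j). if i = j then \<one>\<^bsub>R\<^esub> else \<zero>\<^bsub>R\<^esub>),
     zero = mat n n (\<lambda>(i, j). \<zero>\<^bsub>R\<^esub>),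
     add = (\<lambda>A B. mat n n (\<lambda>(i, j). A $$ (i, j) \<oplus>\<^bsub>R\<^esub> B $$ (i, j)))\<rparr>"

end

(* If a is nilpotent in R, then A = [[0, 1], [0, a]] is nilpotent in T_2(R) and X = [[-a, 1], [0, 0]]
   satisfies X A = 0; with E = [[1, 0], [0, 0]], the LNZS property gives
   X E A = [[0, -a], [0, 0]] = 0, so a = 0.
   Conversely, if R is reduced, a nilpotent of T_2(R) has zero diagonal, so its left annihilator
   is {[[x, y], [0, z]] : x a = 0} for its corner entry a.  This is an ideal because left
   annihilators in a reduced ring are: x a = 0 gives (a x)^2 = 0, so a x = 0, so
   (x r a)^2 = 0, so x r a = 0. *)
theory Submission
  imports Defs
begin

text \<open>Coordinates on the 2 by 2 upper triangular ring: once elements are written by their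
  three free entries, identities there reduce to identities in \<open>R\<close>. The argument
  \<open>R\<close> supplies only the zero below the diagonal.\<close>

definition upper_mat2 :: "('a, 'b) ring_scheme \<Rightarrow> 'a \<Rightarrow> 'a \<Rightarrow> 'a \<Rightarrow> 'a mat" where
  "upper_mat2 R a b c = mat 2 2 (\<lambda>(i, j). if j < i then \<zero>\<^bsub>R\<^esub> else if i = j then (if i = 0 then a else c) else b)"

lemma upper_mat2_index [simp]:
  "upper_mat2 R a b c $$ (0, 0) = a"
  "upper_mat2 R a b c $$ (0, Suc 0) = b"
  "upper_mat2 R a b c $$ (Suc 0, 0) = \<zero>\<^bsub>R\<^esub>"
  "upper_mat2 R a b c $$ (Suc 0, Suc 0) = c"
  by (simp_all add: upper_mat2_def)

lemma upper_mat2_eq_iff [simp]: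
  "upper_mat2 R a b c = upper_mat2 R a' b' c' \<longleftrightarrow> a = a' \<and> b = b' \<and> c = c'"
  by (metis upper_mat2_index(1,2,4))

lemma mat_2_eq_upper_mat2:
  assumes "f (1, 0) = \<zero>\<^bsub>R\<^esub>"
  shows "mat 2 2 f = upper_mat2 R (f (0, 0)) (f (0, 1)) (f (1, 1))"
  using assms by (auto simp: upper_mat2_def less_2_cases_iff intro!: eq_matI)

context ring
begin

abbreviation T2 :: "'a mat ring" where
  "T2 \<equiv> upper_triangular_ring 2 R"

lemma T2_carrierE:
  assumes "A \<in> carrier T2"
  obtains a b c where "a \<in> carrier R" "b \<in> carrier R" "c \<in> carrier R" "A = upper_mat2 R a b c"
proof
  show "A $$ (0, 0) \<in> carrier R" "A $$ (0, 1) \<in> carrier R" "A $$ (1, 1) \<in> carrier R"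
    using assms by (auto simp: upper_triangular_ring_def)
  show "A = upper_mat2 R (A $$ (0, 0)) (A $$ (0, 1)) (A $$ (1, 1))"
    using assms
    by (auto simp: upper_triangular_ring_def upper_mat2_def less_2_cases_iff intro!: eq_matI)
qed

lemma upper_mat2_in_T2 [simp]:
  "upper_mat2 R a b c \<in> carrier T2 \<longleftrightarrow> a \<in> carrier R \<and> b \<in> carrier R \<and> c \<in> carrier R"
proof -
  have "upper_mat2 R a b c \<in> carrier_mat 2 2"
    by (simp add: upper_mat2_def)
  then show ?thesis
    by (auto simp: upper_triangular_ring_def numeral_2_eq_2 All_less_Suc)
qed

lemma T2_zero: "\<zero>\<^bsub>T2\<^esub> = upper_mat2 R \<zero> \<zero> \<zero>"
  by (simp add: upper_triangular_ring_def mat_2_eq_upper_mat2)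

lemma T2_one: "\<one>\<^bsub>T2\<^esub> = upper_mat2 R \<one> \<zero> \<one>"
  by (simp add: upper_triangular_ring_def mat_2_eq_upper_mat2)

lemma T2_add:
  "upper_mat2 R a b c \<oplus>\<^bsub>T2\<^esub> upper_mat2 R a' b' c' = upper_mat2 R (a \<oplus> a') (b \<oplus> b') (c \<oplus> c')"
  by (simp add: upper_triangular_ring_def mat_2_eq_upper_mat2)

lemma T2_mult:
  assumes "a \<in> carrier R" "b \<in> carrier R" "c \<in> carrier R"
    and "a' \<in> carrier R" "b' \<in> carrier R" "c' \<in> carrier R"
  shows "upper_mat2 R a b c \<otimes>\<^bsub>T2\<^esub> upper_mat2 R a' b' c' =
    upper_mat2 R (a \<otimes> a') (a \<otimes> b' \<oplus> b \<otimes> c') (c \<otimes> c')"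
proof -
  \<comment> \<open>Unfolding \<open>{..<2}\<close> inserts 1 before 0, so the terms come out
    reversed and \<open>a_comm\<close> is needed.\<close>
  have sum2: "(\<Oplus>k\<in>{..<2}. g k) = g 0 \<oplus> g 1" if "g 0 \<in> carrier R" "g 1 \<in> carrier R" for g :: "nat \<Rightarrow> 'a"
    using that by (simp add: numeral_2_eq_2 lessThan_Suc Pi_def a_comm)
  show ?thesis
    using assms by (simp add: upper_triangular_ring_def sum2 mat_2_eq_upper_mat2)
qed

lemmas T2_simps = T2_zero T2_one T2_add T2_mult

text \<open>\<open>LNZS\<close> includes being a ring, and this also makes the general ring lemmas
  available for \<open>T2\<close>.\<close>

lemma ring_T2: "ring T2"
proof (rule ringI)
  show "abelian_group T2"
  proof (rule abelian_groupI)
    show "\<exists>B\<in>carrier T2. B \<oplus>\<^bsub>T2\<^esub> A = \<zero>\<^bsub>T2\<^esub>" if "A \<in> carrier T2" for A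
    proof -
      obtain a b c where "a \<in> carrier R" "b \<in> carrier R" "c \<in> carrier R" "A = upper_mat2 R a b c"
        using \<open>A \<in> carrier T2\<close> by (rule T2_carrierE)
      then show ?thesis
        by (intro bexI[of _ "upper_mat2 R (\<ominus> a) (\<ominus> b) (\<ominus> c)"]) (simp_all add: T2_simps l_neg)
    qed
  qed (auto elim!: T2_carrierE simp: T2_simps a_ac)
  show "monoid T2"
    by (rule monoidI) (auto elim!: T2_carrierE simp: T2_simps l_distr r_distr m_assoc a_assoc)
qed (auto elim!: T2_carrierE simp: T2_simps l_distr r_distr a_ac)

text \<open>Both diagonal entries are multiplicative. Nilpotency of the diagonal needs no formula
  for the corner \<open>d\<close>, so it stays existential.\<close>

lemma T2_pow:
  assumes "a \<in> carrier R" "b \<in> carrier R" "c \<in> carrier R"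
  shows "\<exists>d\<in>carrier R. upper_mat2 R a b c [^]\<^bsub>T2\<^esub> (n::nat) = upper_mat2 R (a [^] n) d (c [^] n)"
proof (induction n)
  case 0
  show ?case by (auto simp: T2_one)
next
  case (Suc n)
  then obtain d where "d \<in> carrier R"
    and "upper_mat2 R a b c [^]\<^bsub>T2\<^esub> n = upper_mat2 R (a [^] n) d (c [^] n)"
    by blast
  with assms show ?case by (auto simp: T2_mult)
qed

text \<open>The corner lags one power behind the diagonal, so \<open>a [^] n = \<zero>\<close> kills
  the power \<open>Suc n\<close>. Exponent 0 is excluded because it gives the identity
  matrix.\<close>

lemma T2_pow_Suc:
  assumes "a \<in> carrier R"
  shows "upper_mat2 R \<zero> \<one> a [^]\<^bsub>T2\<^esub> Suc n = upper_mat2 R \<zero> (a [^] n) (a [^] Suc n)"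
proof (induction n)
  case 0
  interpret T: ring T2 by (rule ring_T2)
  show ?case using assms by simp
next
  case (Suc n)
  have "upper_mat2 R \<zero> \<one> a [^]\<^bsub>T2\<^esub> Suc (Suc n) =
      upper_mat2 R \<zero> (a [^] n) (a [^] Suc n) \<otimes>\<^bsub>T2\<^esub> upper_mat2 R \<zero> \<one> a"
    using Suc.IH by simp
  then show ?case using assms by (simp add: T2_mult)
qed

lemma nilpotents_T2_diagonal:
  assumes "upper_mat2 R a b c \<in> nilpotents T2"
  shows "a \<in> nilpotents R" "c \<in> nilpotents R"
proof -
  obtain n :: nat where "n \<ge> 1" and zero: "upper_mat2 R a b c [^]\<^bsub>T2\<^esub> n = \<zero>\<^bsub>T2\<^esub>"
    and car: "a \<in> carrier R" "b \<in> carrier R" "c \<in> carrier R"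
    using assms by (auto simp: nilpotents_def)
  moreover have "a [^] n = \<zero>" "c [^] n = \<zero>"
    using T2_pow[OF car, of n] zero by (auto simp: T2_zero)
  ultimately show "a \<in> nilpotents R" "c \<in> nilpotents R"
    by (auto simp: nilpotents_def)
qed

lemma zero_in_nilpotents: "\<zero> \<in> nilpotents R"
  by (auto simp: nilpotents_def intro!: exI[of _ "1::nat"])

lemma reduced_square_zero:
  assumes "nilpotents R = {\<zero>}" "x \<in> carrier R" "x \<otimes> x = \<zero>"
  shows "x = \<zero>"
proof -
  have "x [^] (2::nat) = \<zero>"
    using assms by (simp add: numeral_2_eq_2)
  then have "x \<in> nilpotents R"
    using assms(2) by (auto simp: nilpotents_def intro!: exI[of _ "2::nat"])
  with assms(1) show ?thesis by simp
qed

text \<open>Reducedness is used twice: first to reverse the product \<open>x \<otimes> a\<close>,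
  then on a square that contains the reversed product.\<close>

lemma reduced_mult_zero_insert:
  assumes red: "nilpotents R = {\<zero>}"
    and car: "x \<in> carrier R" "a \<in> carrier R" "r \<in> carrier R"
    and xa: "x \<otimes> a = \<zero>"
  shows "x \<otimes> r \<otimes> a = \<zero>"
proof -
  have "(a \<otimes> x) \<otimes> (a \<otimes> x) = a \<otimes> (x \<otimes> a) \<otimes> x"
    using car by (simp add: m_assoc)
  then have ax: "a \<otimes> x = \<zero>"
    using reduced_square_zero[OF red, of "a \<otimes> x"] car xa by simp
  have "(x \<otimes> r \<otimes> a) \<otimes> (x \<otimes> r \<otimes> a) = x \<otimes> r \<otimes> (a \<otimes> x) \<otimes> r \<otimes> a"
    using car by (simp add: m_assoc)
  then show ?thesis
    using reduced_square_zero[OF red, of "x \<otimes> r \<otimes> a"] car ax by simp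
qed

text \<open>A left annihilator is always a left ideal, so only closure under right multiplication
  has to be supplied.\<close>

lemma left_annihilator_idealI:
  assumes a: "a \<in> carrier R"
    and right: "\<And>x r. x \<in> carrier R \<Longrightarrow> r \<in> carrier R \<Longrightarrow> x \<otimes> a = \<zero> \<Longrightarrow> x \<otimes> r \<otimes> a = \<zero>"
  shows "ideal (left_annihilator R a) R"
proof (rule idealI)
  show "ring R" by (rule ring_axioms)
  show "subgroup (left_annihilator R a) (add_monoid R)"
  proof (rule subgroup.intro)
    show "inv\<^bsub>add_monoid R\<^esub> x \<in> left_annihilator R a" if "x \<in> left_annihilator R a" for x
      \<comment> \<open>The inverse in \<open>add_monoid R\<close> is folded back to
        \<open>\<ominus>\<close> so that \<open>l_minus\<close> applies.\<close>
      using that a by (auto simp: left_annihilator_def l_minus simp flip: a_inv_def)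
  qed (use a in \<open>auto simp: left_annihilator_def l_distr\<close>)
qed (use a right in \<open>auto simp: left_annihilator_def m_assoc\<close>)

lemma reduced_imp_LNZS_T2:
  assumes red: "nilpotents R = {\<zero>}"
  shows "LNZS T2"
  unfolding LNZS_def
proof (intro conjI ballI)
  interpret T: ring T2 by (rule ring_T2)
  show "ring T2" by (rule ring_T2)
  fix A assume A: "A \<in> nilpotents T2"
  then have "A \<in> carrier T2" by (simp add: nilpotents_def)
  then obtain p a q where pq: "p \<in> carrier R" "q \<in> carrier R" and a: "a \<in> carrier R"
    and A_eq: "A = upper_mat2 R p a q"
    by (rule T2_carrierE)
  with A red have "p = \<zero>" "q = \<zero>"
    using nilpotents_T2_diagonal by blast+
  with A_eq have A_eq: "A = upper_mat2 R \<zero> a \<zero>" by simp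
  show "ideal (left_annihilator T2 A) T2"
  proof (rule T.left_annihilator_idealI)
    show "A \<in> carrier T2" by fact
    fix X B assume "X \<in> carrier T2" "B \<in> carrier T2" "X \<otimes>\<^bsub>T2\<^esub> A = \<zero>\<^bsub>T2\<^esub>"
    \<comment> \<open>With top left entries x of \<open>X\<close> and r of \<open>B\<close>, the
      only possibly nonzero entry of the product is the corner x r a, while the hypothesis says x a
      = 0.\<close>
    then show "X \<otimes>\<^bsub>T2\<^esub> B \<otimes>\<^bsub>T2\<^esub> A = \<zero>\<^bsub>T2\<^esub>"
      using a by (auto elim!: T2_carrierE simp: A_eq T2_simps reduced_mult_zero_insert[OF red])
  qed
qed

lemma LNZS_T2_nilpotent_eq_zero:
  assumes T: "LNZS T2" and a: "a \<in> nilpotents R"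
  shows "a = \<zero>"
proof -
  obtain n :: nat where car: "a \<in> carrier R" and an: "a [^] n = \<zero>"
    using a by (auto simp: nilpotents_def)
  \<comment> \<open>In the corner of the product of \<open>X\<close> and \<open>A\<close> the terms
    \<open>\<ominus> a\<close> and \<open>a\<close> cancel. Right multiplication by \<open>E\<close>
    erases the second column of \<open>X\<close>, so after inserting \<open>E\<close> only
    \<open>\<ominus> a\<close> survives.\<close>
  define A X E where "A = upper_mat2 R \<zero> \<one> a" and "X = upper_mat2 R (\<ominus> a) \<one> \<zero>"
    and "E = upper_mat2 R \<one> \<zero> \<zero>"
  note defs = A_def X_def E_def
  have "A [^]\<^bsub>T2\<^esub> Suc n = \<zero>\<^bsub>T2\<^esub>"
    unfolding A_def T2_pow_Suc[OF car] using car an by (simp add: T2_zero)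
  then have "A \<in> nilpotents T2"
    using car unfolding nilpotents_def by (auto simp: A_def intro!: exI[of _ "Suc n"])
  then have "ideal (left_annihilator T2 A) T2"
    using T by (simp add: LNZS_def)
  moreover have "X \<in> left_annihilator T2 A"
    using car by (simp add: left_annihilator_def defs T2_simps l_neg)
  moreover have "E \<in> carrier T2"
    by (simp add: E_def)
  ultimately have "X \<otimes>\<^bsub>T2\<^esub> E \<in> left_annihilator T2 A"
    by (rule ideal.I_r_closed)
  then have "\<ominus> a = \<zero>"
    using car by (simp add: left_annihilator_def defs T2_simps)
  then show ?thesis
    using car minus_minus[of a] by simp
qed

end

theorem theorem2p2:
  fixes R :: "('a, 'b) ring_scheme"
  assumes "ring R"
  shows "LNZS (upper_triangular_ring 2 R) \<longleftrightarrow> reduced_ring R"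
proof -
  interpret ring R by fact
  show ?thesis
  proof
    assume "LNZS T2"
    then have "nilpotents R = {\<zero>\<^bsub>R\<^esub>}"
      using LNZS_T2_nilpotent_eq_zero zero_in_nilpotents by blast
    with assms show "reduced_ring R" by (simp add: reduced_ring_def)
  next
    assume "reduced_ring R"
    then show "LNZS T2" by (simp add: reduced_ring_def reduced_imp_LNZS_T2)
  qed
qed

end
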